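(* Consider the linear program (LP) of the context in the case where the power constraint (a) is tight, $\bar P=p_{max}<\alpha\sum_{m=1}^M\eta_mP_m$. Let $\{y^*_{i,m}\}$ be its optimal solution, with the threshold structure, thresholds $0=i_1^*\le\cdots\le i_M^*$ and index $\tilde m$ described in the context, and let $\pi_i^*=\sum_{m=1}^M\eta_my^*_{i,m}$ be the optimal steady-state probabilities. With $\varphi_{1,i},\varphi_{2,i},\theta_1,\theta_2$ as defined in the context, let $\nu_1=\sum_{i=0}^{i_M^*}\varphi_{1,i}$ and $\nu_2=\sum_{i=0}^{i_M^*}\varphi_{2,i}$. Then the optimal steady-state probability $\pi_i^*$ can be expressed as a linear function of the optimal steady-state probability $\pi_0^*$: $$\pi_i^*=\frac{\varphi_{2,i}}{\nu_2}+\left(\varphi_{1,i}-\frac{\nu_1}{\nu_2}\varphi_{2,i}\right)\pi_0^*,$$ where $\pi_0^*$ is obtained as $$\pi_0^*=\left(\frac{p_{max}}{\alpha}-\frac{\theta_2}{\nu_2}\right)\left(\theta_1-\frac{\nu_1}{\nu_2}\theta_2\right)^{-1}.$$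
   Context: Data: a positive integer $M$ (number of channel states), $\mathcal M=\{1,\dots,M\}$; $\alpha\in(0,1)$ (packet arrival probability per slot); $\xi=\frac{1-\alpha}{\alpha}$; channel state probabilities $\eta_1,\dots,\eta_M$ with $\sum_m\eta_m=1$; powers $P_1\le\cdots\le P_M$; buffer capacity $Q$, a positive integer or $\infty$; $\mathcal Q=\{0,1,\dots,Q\}$ (all nonnegative integers if $Q=\infty$); a maximum average power $p_{max}$. (LP), in variables $\{y_{i,m}\}_{i\in\mathcal Q,m\in\mathcal M}$: minimize $\bar D=\frac1\alpha\sum_{i=0}^{Q}\sum_{m=1}^{M}i\eta_my_{i,m}$ subject to (a) $\bar P=\alpha\sum_{i=0}^{Q}\sum_{m=1}^{M}\eta_mP_my_{i,m}\le p_{max}$ (tight means equality); (b) $\sum_{i=0}^{Q}\sum_{m=1}^{M}\eta_my_{i,m}=1$; (c) $0\le y_{i,m}\le\sum_{n=1}^M\eta_ny_{i,n}+\xi\sum_{n=1}^M\eta_ny_{i+1,n}$ for all $i\in\mathcal Q,m\in\mathcal M$. Here $y_{i,m}$ is read as $0$ for $i$ outside $\mathcal Q$. It is assumed that no buffer overflow occurs, i.e. if $Q<\infty$ then $\sum_m\eta_my_{Q,m}=0$. Threshold structure of the optimal solution: there are thresholds $0=i_1^*\le\cdots\le i_M^*$ such that $y^*_{i,m}=0$ for $i<i_m^*-1$ and $y^*_{i,m}=\pi_i^*+\xi\pi_{i+1}^*$ for $i\ge i_m^*$; and there is at most one $\tilde m\in\{2,\dots,M\}$ such that $y^*_{i^*_{\tilde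 m}-1,\tilde m}>0$ may hold, with $y^*_{i_m^*-1,m}=0$ for $m\in\{2,\dots,M\}\setminus\{\tilde m\}$. Below, $\tilde m$ is this index. Definitions. For $i\ge0$, $\Gamma(i)=\max\{m\in\mathcal M: i_m^*\le i\}$. For $k\in\mathcal M$, $$\chi(k)=\frac{1-\sum_{m=1}^k\eta_m}{\xi\sum_{m=1}^k\eta_m}.$$ For $i\in\mathcal Q$, $$\varphi_{1,i}=\begin{cases}1,& i=0,\\ \big(\chi(\Gamma(i-1))\big)^{\,i-i^*_{\Gamma(i-1)}}\prod\limits_{m=1}^{\Gamma(i-1)-1}\big(\chi(m)\big)^{i^*_{m+1}-i^*_m},& i>0,\end{cases}$$ $$\varphi_{2,i}=\begin{cases}0,& i<i^*_{\tilde m},\\ -\dfrac{\eta_{\tilde m}}{\xi\sum_{m=1}^{\tilde m-1}\eta_m}\big(\chi(\Gamma(i-1))\big)^{\,i-i^*_{\Gamma(i-1)}}\prod\limits_{m=\tilde m}^{\Gamma(i-1)-1}\big(\chi(m)\big)^{i^*_{m+1}-i^*_m},& i\ge i^*_{\tilde m}.\end{cases}$$ Finally $$\theta_1=\sum_{m=1}^M\eta_m\Big[\varphi_{1,i_m^*}+(1+\xi)\sum_{i=i_m^*+1}^{i_M^*}\varphi_{1,i}\Big]P_m,$$ $$\theta_2=\sum_{m=1}^M\eta_m\Big[\varphi_{2,i_m^*}+(1+\xi)\sum_{i=i_m^*+1}^{i_M^*}\varphi_{2,i}\Big]P_m+\eta_{\tilde m}P_{\tilde m}.$$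
   Formalization: Products in φ_2 with reversed limits are read as reciprocals (not 1); i*_m̃ ≥ 1 is the first state where channel m̃ is used in full; if P_{m̃-1}=P_m̃, a positive entry below i*_m̃ requires i*_{m̃-1}<i*_m̃; all η_m>0 and P_m≥0. *)

theory Defs
  imports "HOL-Analysis.Analysis"
begin

text \<open>Channel states are the naturals \<open>1, \<dots>, M\<close>; LP variables, thresholds and channel parameters are
  functions on \<open>nat\<close> that are only read at channel indices in \<open>{1..M}\<close>.\<close>

definition queue_states :: "enat \<Rightarrow> nat set" where
  "queue_states Q = {i. enat i \<le> Q}"

definition xi :: "real \<Rightarrow> real" where
  "xi \<alpha> = (1 - \<alpha>) / \<alpha>"

definition state_prob :: "nat \<Rightarrow> (nat \<Rightarrow> real) \<Rightarrow> (nat \<Rightarrow> nat \<Rightarrow> real) \<Rightarrow> nat \<Rightarrow> real" where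
  "state_prob M \<eta> y i = (\<Sum>m=1..M. \<eta> m * y i m)"

text \<open>The upper bound of \<open>y i m\<close> in the LP; a channel is used in full in state \<open>i\<close> when the bound is
  attained.\<close>

definition full_rate :: "nat \<Rightarrow> real \<Rightarrow> (nat \<Rightarrow> real) \<Rightarrow> (nat \<Rightarrow> nat \<Rightarrow> real) \<Rightarrow> nat \<Rightarrow> real" where
  "full_rate M \<alpha> \<eta> y i = state_prob M \<eta> y i + xi \<alpha> * state_prob M \<eta> y (Suc i)"

definition avg_power ::
  "nat \<Rightarrow> real \<Rightarrow> (nat \<Rightarrow> real) \<Rightarrow> (nat \<Rightarrow> real) \<Rightarrow> enat \<Rightarrow> (nat \<Rightarrow> nat \<Rightarrow> real) \<Rightarrow> real" where
  "avg_power M \<alpha> \<eta> P Q y = \<alpha> * (\<Sum>\<^sub>\<infinity>i\<in>queue_states Q. \<Sum>m=1..M. \<eta> m * P m * y i m)"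

text \<open>For an infinite buffer the delay of a feasible point may be infinite, hence the extended reals;
  the terms are nonnegative on feasible points, so \<open>ennreal\<close> does not truncate there.\<close>

definition avg_delay ::
  "nat \<Rightarrow> real \<Rightarrow> (nat \<Rightarrow> real) \<Rightarrow> enat \<Rightarrow> (nat \<Rightarrow> nat \<Rightarrow> real) \<Rightarrow> ennreal" where
  "avg_delay M \<alpha> \<eta> Q y =
     ennreal (1 / \<alpha>) * (\<Sum>\<^sub>\<infinity>i\<in>queue_states Q. ennreal (\<Sum>m=1..M. real i * \<eta> m * y i m))"

text \<open>The normalisation (an infinite sum equal to \<open>1\<close>, hence convergent) together with \<open>0 \<le> y\<close> makes
  the series in \<open>avg_power\<close> converge. The last conjunct says that there is no buffer overflow.\<close>

definition lp_feasible ::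
  "nat \<Rightarrow> real \<Rightarrow> (nat \<Rightarrow> real) \<Rightarrow> (nat \<Rightarrow> real) \<Rightarrow> enat \<Rightarrow> real \<Rightarrow> (nat \<Rightarrow> nat \<Rightarrow> real) \<Rightarrow> bool" where
  "lp_feasible M \<alpha> \<eta> P Q pmax y \<longleftrightarrow>
     (\<forall>i m. i \<notin> queue_states Q \<and> m \<in> {1..M} \<longrightarrow> y i m = 0) \<and>
     avg_power M \<alpha> \<eta> P Q y \<le> pmax \<and>
     (\<Sum>\<^sub>\<infinity>i\<in>queue_states Q. \<Sum>m=1..M. \<eta> m * y i m) = 1 \<and>
     (\<forall>i\<in>queue_states Q. \<forall>m\<in>{1..M}. 0 \<le> y i m \<and> y i m \<le> full_rate M \<alpha> \<eta> y i) \<and>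
     (\<forall>q. Q = enat q \<longrightarrow> state_prob M \<eta> y q = 0)"

definition lp_optimal ::
  "nat \<Rightarrow> real \<Rightarrow> (nat \<Rightarrow> real) \<Rightarrow> (nat \<Rightarrow> real) \<Rightarrow> enat \<Rightarrow> real \<Rightarrow> (nat \<Rightarrow> nat \<Rightarrow> real) \<Rightarrow> bool" where
  "lp_optimal M \<alpha> \<eta> P Q pmax y \<longleftrightarrow>
     lp_feasible M \<alpha> \<eta> P Q pmax y \<and>
     (\<forall>z. lp_feasible M \<alpha> \<eta> P Q pmax z \<longrightarrow> avg_delay M \<alpha> \<eta> Q y \<le> avg_delay M \<alpha> \<eta> Q z)"

text \<open>Threshold structure with thresholds \<open>th 1 \<le> \<dots> \<le> th M\<close>, where \<open>k\<close> is the one channel for which the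
  entry just below its threshold may be positive. The last three conjuncts fix what it means for
  \<open>th k\<close> to be the threshold of \<open>k\<close> and for this entry to be allowed to be positive:
  \<^item> the state \<open>th k - 1\<close> exists;
  \<^item> \<open>k\<close> is not yet used in full in that state, i.e. \<open>th k\<close> is the first state of full use. (If it were,
    the same point would also be described by lowering \<open>th k\<close> by one, and with the larger value the
    quantity inverted in the formula for the empty-buffer probability can be zero.)
  \<^item> channels of equal power are interchangeable in the LP; a tie is resolved in favour of the smaller
    index, so a positive entry below \<open>th k\<close> means that channel \<open>k - 1\<close> has passed its threshold there.
    For strictly increasing powers this conjunct is void.\<close>

definition threshold_structure ::
  "nat \<Rightarrow> real \<Rightarrow> (nat \<Rightarrow> real) \<Rightarrow> (nat \<Rightarrow> real) \<Rightarrow> enat \<Rightarrow> (nat \<Rightarrow> nat \<Rightarrow> real) \<Rightarrow>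
   (nat \<Rightarrow> nat) \<Rightarrow> nat \<Rightarrow> bool" where
  "threshold_structure M \<alpha> \<eta> P Q y th k \<longleftrightarrow>
     th 1 = 0 \<and> mono_on {1..M} th \<and>
     (\<forall>m\<in>{1..M}. \<forall>i\<in>queue_states Q.
        (Suc i < th m \<longrightarrow> y i m = 0) \<and> (th m \<le> i \<longrightarrow> y i m = full_rate M \<alpha> \<eta> y i)) \<and>
     k \<in> {2..M} \<and>
     (\<forall>m\<in>{2..M} - {k}. 0 < th m \<longrightarrow> y (th m - 1) m = 0) \<and>
     0 < th k \<and>
     y (th k - 1) k < full_rate M \<alpha> \<eta> y (th k - 1) \<and>
     (0 < y (th k - 1) k \<and> P (k - 1) = P k \<longrightarrow> th (k - 1) < th k)"

definition Gam :: "nat \<Rightarrow> (nat \<Rightarrow> nat) \<Rightarrow> nat \<Rightarrow> nat" where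
  "Gam M th i = Max {m \<in> {1..M}. th m \<le> i}"

definition chi :: "real \<Rightarrow> (nat \<Rightarrow> real) \<Rightarrow> nat \<Rightarrow> real" where
  "chi \<alpha> \<eta> k = (1 - (\<Sum>m=1..k. \<eta> m)) / (xi \<alpha> * (\<Sum>m=1..k. \<eta> m))"

text \<open>The product of \<open>f m\<close> for \<open>m = a, \<dots>, b - 1\<close>, with the usual convention for definite products whose
  upper limit lies below the lower one, so that \<open>iprod f a b * iprod f b c = iprod f a c\<close> whenever
  \<open>f\<close> does not vanish. The reversed case occurs in \<open>phi2\<close> exactly at \<open>i = th k\<close>, where
  \<open>Gam M th (i - 1) < k\<close>; there the reversed product cancels the power of \<open>chi\<close> in front of it, as the
  balance equation between the states \<open>th k - 1\<close> and \<open>th k\<close> requires.\<close>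

definition iprod :: "(nat \<Rightarrow> real) \<Rightarrow> nat \<Rightarrow> nat \<Rightarrow> real" where
  "iprod f a b = (if a \<le> b then \<Prod>m=a..<b. f m else inverse (\<Prod>m=b..<a. f m))"

definition phi1 :: "nat \<Rightarrow> real \<Rightarrow> (nat \<Rightarrow> real) \<Rightarrow> (nat \<Rightarrow> nat) \<Rightarrow> nat \<Rightarrow> real" where
  "phi1 M \<alpha> \<eta> th i =
     (if i = 0 then 1
      else chi \<alpha> \<eta> (Gam M th (i - 1)) ^ (i - th (Gam M th (i - 1))) *
           iprod (\<lambda>m. chi \<alpha> \<eta> m ^ (th (m + 1) - th m)) 1 (Gam M th (i - 1)))"

definition phi2 :: "nat \<Rightarrow> real \<Rightarrow> (nat \<Rightarrow> real) \<Rightarrow> (nat \<Rightarrow> nat) \<Rightarrow> nat \<Rightarrow> nat \<Rightarrow> real" where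
  "phi2 M \<alpha> \<eta> th k i =
     (if i < th k then 0
      else - (\<eta> k / (xi \<alpha> * (\<Sum>m=1..k-1. \<eta> m))) *
           chi \<alpha> \<eta> (Gam M th (i - 1)) ^ (i - th (Gam M th (i - 1))) *
           iprod (\<lambda>m. chi \<alpha> \<eta> m ^ (th (m + 1) - th m)) k (Gam M th (i - 1)))"

definition theta1 ::
  "nat \<Rightarrow> real \<Rightarrow> (nat \<Rightarrow> real) \<Rightarrow> (nat \<Rightarrow> real) \<Rightarrow> (nat \<Rightarrow> nat) \<Rightarrow> real" where
  "theta1 M \<alpha> \<eta> P th =
     (\<Sum>m=1..M. \<eta> m *
        (phi1 M \<alpha> \<eta> th (th m) + (1 + xi \<alpha>) * (\<Sum>i=th m + 1..th M. phi1 M \<alpha> \<eta> th i)) * P m)"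

definition theta2 ::
  "nat \<Rightarrow> real \<Rightarrow> (nat \<Rightarrow> real) \<Rightarrow> (nat \<Rightarrow> real) \<Rightarrow> (nat \<Rightarrow> nat) \<Rightarrow> nat \<Rightarrow> real" where
  "theta2 M \<alpha> \<eta> P th k =
     (\<Sum>m=1..M. \<eta> m *
        (phi2 M \<alpha> \<eta> th k (th m) + (1 + xi \<alpha>) * (\<Sum>i=th m + 1..th M. phi2 M \<alpha> \<eta> th k i)) * P m)
     + \<eta> k * P k"

end

theory Submission
  imports Defs
begin

text \<open>For a policy of threshold form the balance equations give the stationary distribution as
  \<open>\<pi> i = \<phi>1 i * \<pi> 0 + \<phi>2 i * w\<close>, where \<open>w = y (th k - 1) k\<close> is the one entry that the thresholds leave
  open; normalisation and the tight power constraint are then two linear equations for \<open>\<pi> 0\<close> and \<open>w\<close>.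
  That they are independent uses optimality: there is slack to increase \<open>w\<close> within the
  threshold form, this lowers the delay, hence it must raise the power strictly.

  The coefficient in \<open>\<phi>2\<close> is the right one only if \<open>th (k - 1) < th k\<close>; in general the distribution is
  \<open>\<phi>1 i * \<pi> 0 + \<phi>2 i * (rho * w)\<close> with a factor \<open>rho \<ge> 1\<close>. If \<open>th (k - 1) = th k\<close> and the powers differ, optimality forces
  \<open>w = 0\<close>, since otherwise load could be moved from channel \<open>k\<close> to the cheaper channel \<open>k - 1\<close>.\<close>

section \<open>Definite products and series of finite support\<close>

text \<open>Anchoring both limits at 1 gives one quotient for forward and reversed products alike.
  Only factors below \<open>n\<close> must be nonzero, so with \<open>n = M\<close> the zero of
  \<open>chi\<close> at channel \<open>M\<close> does no harm.\<close>

lemma iprod_eq_divide: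
  assumes "1 \<le> a" "a \<le> n" "1 \<le> b" "b \<le> n" and nz: "\<And>m. 1 \<le> m \<Longrightarrow> m < n \<Longrightarrow> f m \<noteq> 0"
  shows "iprod f a b = (\<Prod>m=1..<b. f m) / (\<Prod>m=1..<a. f m)"
proof (cases "a \<le> b")
  case True
  have "(\<Prod>m=1..<a. f m) * (\<Prod>m=a..<b. f m) = (\<Prod>m=1..<b. f m)"
    using True assms(1) by (rule prod.atLeastLessThan_concat[rotated])
  moreover have "(\<Prod>m=1..<a. f m) \<noteq> 0"
    using assms by auto
  ultimately show ?thesis
    using True by (simp add: iprod_def field_simps)
next
  case False
  have "(\<Prod>m=1..<b. f m) * (\<Prod>m=b..<a. f m) = (\<Prod>m=1..<a. f m)"
    using False assms(3) by (intro prod.atLeastLessThan_concat) auto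
  moreover have "(\<Prod>m=1..<b. f m) \<noteq> 0" "(\<Prod>m=b..<a. f m) \<noteq> 0"
    using assms by auto
  ultimately have "(\<Prod>m=1..<b. f m) / (\<Prod>m=1..<a. f m) = inverse (\<Prod>m=b..<a. f m)"
    by (metis divide_divide_eq_left divide_self inverse_eq_divide)
  then show ?thesis
    using False by (simp add: iprod_def)
qed

lemma infsum_finite_support:
  fixes f :: "nat \<Rightarrow> 'a :: {topological_comm_monoid_add, t2_space}"
  assumes "enat N \<le> Q" "\<And>i. N < i \<Longrightarrow> f i = 0"
  shows "infsum f (queue_states Q) = (\<Sum>i\<le>N. f i)"
proof -
  have "i \<in> queue_states Q" if "i \<le> N" for i
    using that assms(1) unfolding queue_states_def by (auto intro: order_trans[of _ "enat N"])
  then have "infsum f (queue_states Q) = infsum f {..N}"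
    using assms(2) by (intro infsum_cong_neutral) (auto simp: not_le)
  then show ?thesis
    by simp
qed

section \<open>Thresholds and cumulative channel probabilities\<close>

text \<open>The locale knows nothing of the LP: its facts apply to the optimal point and to
  competitors of the same threshold form.\<close>

locale threshold_params =
  fixes M :: nat and \<alpha> :: real and \<eta> :: "nat \<Rightarrow> real" and th :: "nat \<Rightarrow> nat" and k :: nat
  assumes alpha: "0 < \<alpha>" "\<alpha> < 1"
    and eta_pos: "m \<in> {1..M} \<Longrightarrow> 0 < \<eta> m"
    and eta_sum: "(\<Sum>m=1..M. \<eta> m) = 1"
    and th_1: "th 1 = 0" and th_mono: "mono_on {1..M} th"
    and k_range: "k \<in> {2..M}" and th_k_pos: "0 < th k"
begin

abbreviation \<xi> :: real where "\<xi> \<equiv> xi \<alpha>"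
abbreviation \<Gamma> :: "nat \<Rightarrow> nat" where "\<Gamma> \<equiv> Gam M th"
abbreviation ratio :: "nat \<Rightarrow> real" where "ratio \<equiv> chi \<alpha> \<eta>"
abbreviation \<phi>1 :: "nat \<Rightarrow> real" where "\<phi>1 \<equiv> phi1 M \<alpha> \<eta> th"
abbreviation \<phi>2 :: "nat \<Rightarrow> real" where "\<phi>2 \<equiv> phi2 M \<alpha> \<eta> th k"
abbreviation \<pi> :: "(nat \<Rightarrow> nat \<Rightarrow> real) \<Rightarrow> nat \<Rightarrow> real" where "\<pi> \<equiv> state_prob M \<eta>"
abbreviation full :: "(nat \<Rightarrow> nat \<Rightarrow> real) \<Rightarrow> nat \<Rightarrow> real" where "full \<equiv> full_rate M \<alpha> \<eta>"

definition S :: "nat \<Rightarrow> real" where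
  "S j = (\<Sum>m=1..j. \<eta> m)"

lemma S_M: "S M = 1"
  using eta_sum by (simp add: S_def)

lemma ratio_eq: "ratio j = (1 - S j) / (\<xi> * S j)"
  by (simp add: chi_def S_def)

lemma xi_pos: "0 < \<xi>"
  using alpha by (simp add: xi_def)

lemma th_le: "1 \<le> m \<Longrightarrow> m \<le> n \<Longrightarrow> n \<le> M \<Longrightarrow> th m \<le> th n"
  using th_mono by (auto simp: mono_on_def)

lemma Gam_props: "\<Gamma> i \<in> {1..M}" "th (\<Gamma> i) \<le> i"
proof -
  have "1 \<in> {m \<in> {1..M}. th m \<le> i}"
    using k_range th_1 by auto
  then have "\<Gamma> i \<in> {m \<in> {1..M}. th m \<le> i}"
    unfolding Gam_def by (intro Max_in) auto
  then show "\<Gamma> i \<in> {1..M}" "th (\<Gamma> i) \<le> i"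
    by auto
qed

text \<open>Monotone thresholds make the channels in full use in state \<open>i\<close> an initial
  segment \<open>{1..\<Gamma> i}\<close>; hence \<open>S (\<Gamma> i)\<close> is their total
  probability.\<close>

lemma th_le_iff:
  assumes "m \<in> {1..M}"
  shows "th m \<le> i \<longleftrightarrow> m \<le> \<Gamma> i"
proof
  assume "th m \<le> i"
  then show "m \<le> \<Gamma> i"
    unfolding Gam_def using assms by (intro Max_ge) auto
next
  assume "m \<le> \<Gamma> i"
  then show "th m \<le> i"
    using th_le[of m "\<Gamma> i"] Gam_props[of i] assms by auto
qed

lemma S_split: "i \<le> j \<Longrightarrow> S j = S i + sum \<eta> {i<..j}"
  unfolding S_def by (subst sum.union_disjoint[symmetric]) (auto intro!: sum.cong)

lemma S_less: "i < j \<Longrightarrow> j \<le> M \<Longrightarrow> S i < S j"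
  using S_split[of i j] eta_pos sum_pos[of "{i<..j}" \<eta>] by auto

lemma S_mono: "i \<le> j \<Longrightarrow> j \<le> M \<Longrightarrow> S i \<le> S j"
  using S_less[of i j] by (cases "i = j") fastforce+

lemma S_pos: "1 \<le> j \<Longrightarrow> j \<le> M \<Longrightarrow> 0 < S j"
  using S_less[of 0 j] by (simp add: S_def)

lemma S_less_1: "j < M \<Longrightarrow> S j < 1"
  using S_less[of j M] S_M by simp

lemma ratio_M: "ratio M = 0"
  by (simp add: ratio_eq S_M)

lemma ratio_pos: "1 \<le> j \<Longrightarrow> j < M \<Longrightarrow> 0 < ratio j"
  using S_less_1[of j] S_pos[of j] xi_pos by (simp add: ratio_eq)

lemma Gam_ratio_nonneg: "0 \<le> ratio (\<Gamma> i)"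
  using Gam_props(1)[of i] ratio_pos[of "\<Gamma> i"] ratio_M by (cases "\<Gamma> i = M") auto

section \<open>Recursions behind the closed forms \<open>\<phi>1\<close> and
  \<open>\<phi>2\<close>\<close>

definition ratio_prod :: "nat \<Rightarrow> real" where
  "ratio_prod n = (\<Prod>m=1..<n. ratio m ^ (th (m + 1) - th m))"

lemma ratio_prod_pos: "n \<le> M \<Longrightarrow> 0 < ratio_prod n"
  unfolding ratio_prod_def using ratio_pos by (intro prod_pos) auto

text \<open>The thresholds of the channels \<open>g + 1\<close> to \<open>n\<close> coincide, so
  every factor after the one for \<open>g\<close> has exponent 0.\<close>

lemma ratio_prod_step:
  assumes "1 \<le> g" "g < n" "n \<le> M" "th (g + 1) = th n"
  shows "ratio_prod n = ratio g ^ (th n - th g) * ratio_prod g"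
proof -
  have "(\<Prod>m=g+1..<n. ratio m ^ (th (m + 1) - th m)) = (\<Prod>m=g+1..<n. 1)"
  proof (rule prod.cong)
    fix m assume "m \<in> {g+1..<n}"
    then have "th (m + 1) = th m"
      using assms th_le[of "g+1" m] th_le[of m "m+1"] th_le[of "m+1" n] by auto
    then show "ratio m ^ (th (m + 1) - th m) = 1"
      by simp
  qed auto
  moreover have "ratio_prod n = ratio_prod g * (\<Prod>m=g..<n. ratio m ^ (th (m + 1) - th m))"
    unfolding ratio_prod_def using assms by (intro prod.atLeastLessThan_concat[symmetric]) auto
  ultimately show ?thesis
    using assms by (simp add: prod.atLeast_Suc_lessThan mult.commute)
qed

lemma phi1_eq:
  "\<phi>1 i = (if i = 0 then 1 else ratio (\<Gamma> (i - 1)) ^ (i - th (\<Gamma> (i - 1))) * ratio_prod (\<Gamma> (i - 1)))"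
  using Gam_props[of "i-1"] by (simp add: phi1_def iprod_def ratio_prod_def)

text \<open>The closed form at \<open>th m\<close> refers to \<open>\<Gamma> (th m - 1)\<close>,
  which may lie several channels below \<open>m\<close> when thresholds coincide;
  \<open>ratio_prod_step\<close> bridges this gap.\<close>

lemma phi1_th:
  assumes "m \<in> {1..M}"
  shows "\<phi>1 (th m) = ratio_prod m"
proof (cases "th m = 0")
  case True
  have "(\<Prod>j=1..<m. ratio j ^ (th (j + 1) - th j)) = (\<Prod>j=1..<m. 1)"
    using assms True th_le[of _ m] by (intro prod.cong) fastforce+
  then show ?thesis
    using True by (simp add: phi1_def ratio_prod_def)
next
  case False
  define g where "g = \<Gamma> (th m - 1)"
  have g: "g \<in> {1..M}" "g < m"
    using Gam_props[of "th m - 1"] False assms th_le_iff[of m "th m - 1"] by (auto simp: g_def)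
  have "th (g + 1) = th m"
    using th_le_iff[of "g+1" "th m - 1"] th_le[of "g+1" m] g assms False by (auto simp: g_def)
  then show ?thesis
    using ratio_prod_step[of g m] g assms False by (simp add: phi1_eq g_def)
qed

text \<open>The closed form of \<open>\<phi>1 i\<close> refers to \<open>\<Gamma> (i - 1)\<close>,
  the recursion to \<open>\<Gamma> i\<close>. The two indices agree unless \<open>i\<close> is
  itself the threshold of \<open>\<Gamma> i\<close>, where \<open>phi1_th\<close> gives the
  value.\<close>

lemma phi1_Suc: "\<phi>1 (Suc i) = ratio (\<Gamma> i) * \<phi>1 i"
proof -
  have "\<phi>1 i = ratio (\<Gamma> i) ^ (i - th (\<Gamma> i)) * ratio_prod (\<Gamma> i)"
  proof (cases "th (\<Gamma> i) = i")
    case True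
    then show ?thesis
      using phi1_th[OF Gam_props(1), of i] by simp
  next
    case False
    then have "th (\<Gamma> i) \<le> i - 1" "i > 0"
      using Gam_props(2)[of i] by auto
    moreover have "\<Gamma> (i - 1) \<le> \<Gamma> i"
      using th_le_iff[of "\<Gamma> (i-1)" i] Gam_props[of "i-1"] by auto
    ultimately have "\<Gamma> (i - 1) = \<Gamma> i"
      using th_le_iff[of "\<Gamma> i" "i-1"] Gam_props[of i] by auto
    then show ?thesis
      using \<open>i > 0\<close> by (simp add: phi1_eq)
  qed
  then show ?thesis
    using Gam_props(2)[of i] by (simp add: phi1_eq Suc_diff_le)
qed

lemma phi1_0: "\<phi>1 0 = 1"
  by (simp add: phi1_def)

lemma phi1_nonneg: "0 \<le> \<phi>1 i"
  by (induction i) (auto simp: phi1_Suc Gam_ratio_nonneg phi1_0)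

lemma Gam_eq_M: "th M \<le> i \<Longrightarrow> \<Gamma> i = M"
  using th_le_iff[of M i] Gam_props[of i] by auto

text \<open>From \<open>th M\<close> on all channels are in full use; their probabilities sum to 1,
  so the ratio is 0.\<close>

lemma phi1_zero: "th M < i \<Longrightarrow> \<phi>1 i = 0"
  using phi1_Suc[of "i-1"] ratio_M Gam_eq_M[of "i-1"] by (cases i) auto

text \<open>The value with which \<open>\<phi>2\<close> starts at \<open>th k\<close>. Its
  denominator presumes that channel \<open>k - 1\<close> is in full use in state
  \<open>th k - 1\<close>.\<close>

definition phi2_init :: real where
  "phi2_init = - (\<eta> k / (\<xi> * S (k - 1)))"

lemma phi2_init_neg: "phi2_init < 0"
  using eta_pos[of k] k_range xi_pos S_pos[of "k-1"] unfolding phi2_init_def by auto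

text \<open>Both closed forms carry the same power of \<open>chi\<close>, and their products differ
  only in the starting index; so their quotient is constant from \<open>th k\<close> on. Recursion,
  sign and support are thus inherited from \<open>\<phi>1\<close>.\<close>

lemma phi2_eq: "\<phi>2 i = (if i < th k then 0 else phi2_init * \<phi>1 i / ratio_prod k)"
proof (cases "i < th k")
  case False
  then have "i \<noteq> 0"
    using th_k_pos by auto
  moreover have "iprod (\<lambda>m. ratio m ^ (th (m + 1) - th m)) k (\<Gamma> (i - 1)) =
      ratio_prod (\<Gamma> (i - 1)) / ratio_prod k"
    unfolding ratio_prod_def using Gam_props[of "i-1"] k_range ratio_pos
    by (intro iprod_eq_divide[where n=M]) fastforce+
  ultimately show ?thesis
    using False by (simp add: phi2_def phi1_eq phi2_init_def S_def)
qed (simp add: phi2_def)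

lemma phi2_th: "\<phi>2 (th k) = phi2_init"
  using phi1_th[of k] k_range ratio_prod_pos[of k] by (simp add: phi2_eq)

lemma phi2_Suc: "Suc i \<noteq> th k \<Longrightarrow> \<phi>2 (Suc i) = ratio (\<Gamma> i) * \<phi>2 i"
  by (auto simp: phi2_eq phi1_Suc)

lemma phi2_nonpos: "\<phi>2 i \<le> 0"
  using phi2_init_neg phi1_nonneg[of i] ratio_prod_pos[of k] k_range
  by (auto simp: phi2_eq intro!: divide_nonpos_pos mult_nonpos_nonneg)

lemma phi2_zero: "th M < i \<Longrightarrow> \<phi>2 i = 0"
  by (simp add: phi2_eq phi1_zero)

lemma th_k_le: "th k \<le> th M"
  using th_le[of k M] k_range by auto

lemma nu1_pos: "0 < (\<Sum>i\<le>th M. \<phi>1 i)"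
proof (rule sum_pos2[of _ 0])
qed (auto simp: phi1_nonneg phi1_0)

lemma nu2_neg: "(\<Sum>i\<le>th M. \<phi>2 i) < 0"
proof -
  have "0 < (\<Sum>i\<le>th M. - \<phi>2 i)"
    using th_k_le phi2_init_neg phi2_nonpos by (intro sum_pos2[of _ "th k"]) (auto simp: phi2_th)
  then show ?thesis
    by (simp add: sum_negf)
qed

section \<open>Stationary distribution and power of points of threshold form\<close>

text \<open>These conditions are linear in \<open>y\<close>, hold for all states and contain no
  signs or bounds. The branch \<open>y i k\<close> is a tautology that leaves this one entry
  free.\<close>

definition threshold_form :: "(nat \<Rightarrow> nat \<Rightarrow> real) \<Rightarrow> bool" where
  "threshold_form y \<longleftrightarrow> (\<forall>i. \<forall>m\<in>{1..M}. y i m =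
     (if th m \<le> i then full y i else if m = k \<and> Suc i = th k then y i k else 0))"

text \<open>Balance in state \<open>th k - 1\<close> divides by the probability of the channels in
  full use there, \<open>phi2_init\<close> by \<open>S (k - 1)\<close>. The factor
  \<open>rho\<close> converts one into the other; it is 1 exactly when
  \<open>th (k - 1) < th k\<close>.\<close>

definition rho :: real where
  "rho = S (k - 1) / S (\<Gamma> (th k - 1))"

lemma Gam_below_k: "\<Gamma> (th k - 1) \<in> {1..k - 1}"
  using th_le_iff[of k "th k - 1"] Gam_props[of "th k - 1"] k_range th_k_pos by auto

lemma rho_ge_1: "1 \<le> rho"
proof -
  have "S (\<Gamma> (th k - 1)) \<le> S (k - 1)"
    using Gam_below_k k_range by (intro S_mono) auto
  then show ?thesis
    using S_pos[of "\<Gamma> (th k - 1)"] Gam_below_k k_range by (auto simp: rho_def)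
qed

text \<open>Stated for one row \<open>v\<close> with arbitrary values \<open>f\<close> and
  \<open>u\<close>, since it also evaluates a perturbed row whose entries are not yet known to be
  full rates.\<close>

lemma sum_split_full:
  assumes "\<And>m. m \<in> {1..M} \<Longrightarrow> v m = (if th m \<le> i then f else if m = k \<and> Suc i = th k then u else 0)"
  shows "(\<Sum>m=1..M. \<eta> m * v m) = S (\<Gamma> i) * f + (if Suc i = th k then \<eta> k * u else 0)"
proof -
  have "(\<Sum>m=1..M. \<eta> m * v m) = (\<Sum>m=1..M. (if m \<le> \<Gamma> i then \<eta> m * f else 0) +
      (if m = k then (if Suc i = th k then \<eta> k * u else 0) else 0))"
    by (intro sum.cong) (auto simp: assms th_le_iff[symmetric])
  also have "\<dots> = (\<Sum>m\<in>{m\<in>{1..M}. m \<le> \<Gamma> i}. \<eta> m * f) + (if Suc i = th k then \<eta> k * u else 0)"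
    using k_range by (simp add: sum.distrib sum.inter_filter[symmetric])
  also have "{m\<in>{1..M}. m \<le> \<Gamma> i} = {1..\<Gamma> i}"
    using Gam_props(1)[of i] by auto
  finally show ?thesis
    by (simp add: sum_distrib_right S_def)
qed

context
  fixes y assumes y: "threshold_form y"
begin

lemma entry_eq:
  "m \<in> {1..M} \<Longrightarrow>
    y i m = (if th m \<le> i then full y i else if m = k \<and> Suc i = th k then y i k else 0)"
  using y unfolding threshold_form_def by blast

lemma balance: "\<pi> y i = S (\<Gamma> i) * full y i + (if Suc i = th k then \<eta> k * y i k else 0)"
  unfolding state_prob_def by (rule sum_split_full) (rule entry_eq)

text \<open>The balance equation solved for the term \<open>\<pi> y (Suc i)\<close> hidden in
  \<open>full y i\<close>.\<close>

lemma state_prob_Suc: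
  "\<pi> y (Suc i) = ratio (\<Gamma> i) * \<pi> y i - (if Suc i = th k then \<eta> k * y i k / (\<xi> * S (\<Gamma> i)) else 0)"
proof -
  have "S (\<Gamma> i) * \<xi> \<noteq> 0" "S (\<Gamma> i) \<noteq> 0"
    using S_pos[of "\<Gamma> i"] Gam_props[of i] xi_pos by auto
  then show ?thesis
    using balance[of i] by (auto simp: ratio_eq full_rate_def field_simps)
qed

lemma state_prob_linear:
  "\<pi> y i = \<phi>1 i * \<pi> y 0 + \<phi>2 i * (rho * y (th k - 1) k)"
proof (induction i)
  case 0
  then show ?case
    using th_k_pos by (simp add: phi1_def phi2_def)
next
  case (Suc i)
  show ?case
  proof (cases "Suc i = th k")
    case True
    then have [simp]: "th k - 1 = i" "\<phi>2 i = 0" and 2: "\<phi>2 (Suc i) = phi2_init"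
      using phi2_th phi2_eq[of i] by auto
    have "phi2_init * rho = - \<eta> k / (\<xi> * S (\<Gamma> i))"
      using S_pos[of "k-1"] k_range by (simp add: phi2_init_def rho_def True[symmetric]) linarith
    then have "\<phi>2 (Suc i) * (rho * y i k) = - \<eta> k / (\<xi> * S (\<Gamma> i)) * y i k"
      by (simp only: 2 mult.assoc[symmetric])
    then show ?thesis
      using state_prob_Suc[of i] Suc by (simp add: phi1_Suc True[symmetric])
  next
    case False
    then show ?thesis
      using state_prob_Suc[of i] Suc by (simp add: phi1_Suc phi2_Suc algebra_simps)
  qed
qed

lemma state_prob_zero: "th M < i \<Longrightarrow> \<pi> y i = 0"
  by (subst state_prob_linear) (simp add: phi1_zero phi2_zero)

lemma entry_zero: "th M < i \<Longrightarrow> m \<in> {1..M} \<Longrightarrow> y i m = 0"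
  using th_le[of m M] by (subst entry_eq) (auto simp: full_rate_def state_prob_zero)

lemma sum_state_prob:
  "(\<Sum>i\<le>th M. \<pi> y i) = (\<Sum>i\<le>th M. \<phi>1 i) * \<pi> y 0 + (\<Sum>i\<le>th M. \<phi>2 i) * (rho * y (th k - 1) k)"
proof -
  have "(\<Sum>i\<le>th M. \<pi> y i) = (\<Sum>i\<le>th M. \<phi>1 i * \<pi> y 0 + \<phi>2 i * (rho * y (th k - 1) k))"
    by (intro sum.cong refl state_prob_linear)
  then show ?thesis
    by (simp add: sum.distrib sum_distrib_right)
qed

text \<open>Summing \<open>full\<close> counts a state once for itself and once, with weight
  \<open>\<xi>\<close>, as the successor of the previous one. Only \<open>th m\<close> lacks the
  second count, and nothing is left beyond \<open>th M\<close>; this produces the brackets of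
  \<open>theta1\<close> and \<open>theta2\<close>.\<close>

lemma channel_use:
  assumes m: "m \<in> {1..M}"
  shows "(\<Sum>i\<le>th M. y i m) = \<pi> y (th m) + (1 + \<xi>) * (\<Sum>i=th m + 1..th M. \<pi> y i) +
    (if m = k then y (th k - 1) k else 0)"
proof -
  have le: "th m \<le> th M"
    using th_le[of m M] m by auto
  have "(\<Sum>i\<le>th M. y i m) = (\<Sum>i\<le>th M. (if th m \<le> i then full y i else 0) +
      (if i = th k - 1 then (if m = k then y (th k - 1) k else 0) else 0))"
  proof (intro sum.cong refl)
    fix i
    show "y i m = (if th m \<le> i then full y i else 0) +
        (if i = th k - 1 then (if m = k then y (th k - 1) k else 0) else 0)"
      using th_k_pos by (subst entry_eq[OF m]) auto
  qed
  also have "\<dots> = (\<Sum>i\<in>{i\<in>{..th M}. th m \<le> i}. full y i) + (if m = k then y (th k - 1) k else 0)"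
    using th_k_le by (simp add: sum.distrib sum.inter_filter[symmetric]) linarith
  also have "{i\<in>{..th M}. th m \<le> i} = {th m..th M}"
    by auto
  also have "(\<Sum>i=th m..th M. full y i) = (\<Sum>i=th m..th M. \<pi> y i) + \<xi> * (\<Sum>i=th m..th M. \<pi> y (Suc i))"
    by (simp add: full_rate_def sum.distrib sum_distrib_left)
  also have "(\<Sum>i=th m..th M. \<pi> y (Suc i)) = (\<Sum>i=th m + 1..th M. \<pi> y i)"
    using le state_prob_zero[of "Suc (th M)"] sum.shift_bounds_cl_Suc_ivl[of "\<pi> y" "th m" "th M"]
    by simp
  also have "(\<Sum>i=th m..th M. \<pi> y i) = \<pi> y (th m) + (\<Sum>i=th m + 1..th M. \<pi> y i)"
    using le by (simp add: sum.atLeast_Suc_atMost)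
  finally show ?thesis
    by (simp add: algebra_simps)
qed

text \<open>The open entry itself costs \<open>\<eta> k * P k\<close> without the factor
  \<open>rho\<close>, so this summand of \<open>theta2\<close> is split off before scaling.\<close>

lemma power_linear:
  "(\<Sum>i\<le>th M. \<Sum>m=1..M. \<eta> m * P m * y i m) =
     theta1 M \<alpha> \<eta> P th * \<pi> y 0 +
     (rho * (theta2 M \<alpha> \<eta> P th k - \<eta> k * P k) + \<eta> k * P k) * y (th k - 1) k"
proof -
  define w where "w = rho * y (th k - 1) k"
  have lin: "\<pi> y (th m) + (1 + \<xi>) * (\<Sum>i=th m + 1..th M. \<pi> y i) =
      (\<phi>1 (th m) + (1 + \<xi>) * (\<Sum>i=th m + 1..th M. \<phi>1 i)) * \<pi> y 0 +
      (\<phi>2 (th m) + (1 + \<xi>) * (\<Sum>i=th m + 1..th M. \<phi>2 i)) * w" for m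
    by (subst (1 2) state_prob_linear, fold w_def, simp only: sum.distrib sum_distrib_right[symmetric])
      (simp add: algebra_simps)
  have "(\<Sum>i\<le>th M. \<Sum>m=1..M. \<eta> m * P m * y i m) = (\<Sum>m=1..M. \<eta> m * P m * (\<Sum>i\<le>th M. y i m))"
    by (subst sum.swap) (simp add: sum_distrib_left)
  also have "\<dots> = (\<Sum>m=1..M.
      \<eta> m * (\<phi>1 (th m) + (1 + \<xi>) * (\<Sum>i=th m + 1..th M. \<phi>1 i)) * P m * \<pi> y 0 +
      \<eta> m * (\<phi>2 (th m) + (1 + \<xi>) * (\<Sum>i=th m + 1..th M. \<phi>2 i)) * P m * w +
      (if m = k then \<eta> k * P k * y (th k - 1) k else 0))"
    by (intro sum.cong refl, simp only: channel_use lin) (simp add: algebra_simps)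
  also have "\<dots> = theta1 M \<alpha> \<eta> P th * \<pi> y 0 + (theta2 M \<alpha> \<eta> P th k - \<eta> k * P k) * w +
      \<eta> k * P k * y (th k - 1) k"
    using k_range by (simp add: sum.distrib theta1_def theta2_def sum_distrib_right)
  finally show ?thesis
    by (simp add: w_def algebra_simps)
qed

section \<open>Positivity and competitors when the open entry has slack\<close>

context
  assumes nonneg: "\<And>i m. m \<in> {1..M} \<Longrightarrow> 0 \<le> y i m"
    and slack: "y (th k - 1) k < full y (th k - 1)"
begin

lemma state_prob_nonneg: "0 \<le> \<pi> y i"
  unfolding state_prob_def using nonneg eta_pos by (intro sum_nonneg mult_nonneg_nonneg) (auto simp: less_imp_le)

lemma entry_le_full:
  assumes "m \<in> {1..M}"
  shows "y i m \<le> full y i"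
proof -
  have "0 \<le> full y i"
    unfolding full_rate_def using state_prob_nonneg xi_pos by simp
  moreover have "y i k \<le> full y i" if "Suc i = th k"
    using slack by (simp add: that[symmetric])
  ultimately show ?thesis
    by (subst entry_eq[OF assms]) auto
qed

text \<open>An entry that is nonnegative and strictly below the full rate makes that rate positive,
  and at least channel 1 is in full use.\<close>

lemma state_prob_below_k_pos: "0 < \<pi> y (th k - 1)"
proof -
  have "0 < S (\<Gamma> (th k - 1)) * full y (th k - 1)"
    using S_pos[of "\<Gamma> (th k - 1)"] Gam_props(1)[of "th k - 1"] nonneg[of k "th k - 1"] k_range slack
    by (intro mult_pos_pos) auto
  moreover have "0 \<le> \<eta> k * y (th k - 1) k"
    using nonneg[of k] eta_pos[of k] k_range by auto
  ultimately show ?thesis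
    using balance[of "th k - 1"] th_k_pos by auto
qed

text \<open>If state \<open>th k\<close> were empty, the full rate one state below would equal the
  probability of that state, and the open entry would have to supply the share of all channels
  beyond \<open>\<Gamma> (th k - 1)\<close>. This share is at least \<open>\<eta> k\<close> times
  the full rate, more than an entry with slack contributes.\<close>

lemma state_prob_k_pos: "0 < \<pi> y (th k)"
proof (rule ccontr)
  assume "\<not> 0 < \<pi> y (th k)"
  then have "full y (th k - 1) = \<pi> y (th k - 1)"
    using state_prob_nonneg[of "th k"] th_k_pos by (simp add: full_rate_def)
  then have "(1 - S (\<Gamma> (th k - 1))) * full y (th k - 1) = \<eta> k * y (th k - 1) k"
    using balance[of "th k - 1"] th_k_pos by (simp add: algebra_simps)
  also have "\<dots> < \<eta> k * full y (th k - 1)"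
    using slack eta_pos[of k] k_range by auto
  also have "\<dots> \<le> (1 - S (\<Gamma> (th k - 1))) * full y (th k - 1)"
  proof (intro mult_right_mono)
    have "S (k - 1) + \<eta> k = S k"
      using k_range S_split[of "k-1" k] by (cases k) (auto simp: S_def)
    moreover have "S (\<Gamma> (th k - 1)) \<le> S (k - 1)"
      using Gam_below_k k_range by (intro S_mono) auto
    moreover have "S k \<le> 1"
      using S_mono[of k M] S_M k_range by simp
    ultimately show "\<eta> k \<le> 1 - S (\<Gamma> (th k - 1))"
      by linarith
    show "0 \<le> full y (th k - 1)"
      using nonneg[of k "th k - 1"] slack k_range by auto
  qed
  finally show False
    by simp
qed

text \<open>Below \<open>th M\<close> some channel is not in full use, so the ratio is positive and
  positivity propagates upwards from \<open>th k\<close>.\<close>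

lemma state_prob_pos: "th k \<le> i \<Longrightarrow> i \<le> th M \<Longrightarrow> 0 < \<pi> y i"
proof (induction i rule: dec_induct)
  case base
  show ?case by (rule state_prob_k_pos)
next
  case (step n)
  have "\<Gamma> n \<noteq> M"
    using step Gam_props(2)[of n] by auto
  then have "0 < ratio (\<Gamma> n)"
    using ratio_pos[of "\<Gamma> n"] Gam_props(1)[of n] by auto
  then show ?case
    using step state_prob_Suc[of n] by auto
qed

text \<open>Moves mass from the states above \<open>th k - 1\<close> to the others, which keeps the threshold form and
  is absorbed by a larger entry of channel \<open>k\<close> in state \<open>th k - 1\<close>.\<close>

lemma increase_below_k:
  assumes total: "(\<Sum>i\<le>th M. \<pi> y i) = 1"
  obtains z where "threshold_form z" "\<And>i m. m \<in> {1..M} \<Longrightarrow> 0 \<le> z i m \<and> z i m \<le> full z i"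
    "(\<Sum>i\<le>th M. \<pi> z i) = 1" "(\<Sum>i\<le>th M. real i * \<pi> z i) < (\<Sum>i\<le>th M. real i * \<pi> y i)"
    "y (th k - 1) k < z (th k - 1) k"
proof -
  define j where "j = th k - 1"
  have j: "Suc j = th k" "j < th M"
    using th_k_pos th_k_le by (auto simp: j_def)
  have split: "(\<Sum>i\<le>th M. f i) = (\<Sum>i\<le>j. f i) + (\<Sum>i=Suc j..th M. f i)" for f :: "nat \<Rightarrow> real"
    using j by (subst sum.union_disjoint[symmetric]) (auto intro!: sum.cong)
  define A where "A = (\<Sum>i\<le>j. \<pi> y i)"
  define B where "B = (\<Sum>i=Suc j..th M. \<pi> y i)"
  have AB: "A + B = 1"
    using total by (simp add: split A_def B_def)
  have "0 < A"
    unfolding A_def using state_prob_below_k_pos by (intro sum_pos2[of _ j]) (auto simp: j_def state_prob_nonneg)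
  have "0 < B"
    unfolding B_def using state_prob_k_pos j by (intro sum_pos2[of _ "th k"]) (auto simp: state_prob_nonneg)
  \<comment> \<open>Masses up to \<open>j\<close> will be scaled by \<open>1 + e * B\<close>, those
    above by \<open>1 - e * A\<close>, which preserves \<open>A + B\<close>. Then
    \<open>e * g\<close> is the change of the full rate in \<open>j\<close>, and balance dictates
    the change \<open>e * r\<close> of the entry of channel \<open>k\<close>.\<close>
  define g where "g = B * \<pi> y j - A * \<xi> * \<pi> y (Suc j)"
  define r where "r = (B * \<pi> y j - S (\<Gamma> j) * g) / \<eta> k"
  have S\<Gamma>: "0 < S (\<Gamma> j)" "S (\<Gamma> j) < 1"
    using S_pos[of "\<Gamma> j"] S_less_1[of "\<Gamma> j"] Gam_below_k k_range unfolding j_def by auto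
  have eta_k: "0 < \<eta> k"
    using eta_pos k_range by auto
  have r: "\<eta> k * r = B * \<pi> y j - S (\<Gamma> j) * g"
    using eta_k by (simp add: r_def)
  have "0 < r"
  proof -
    have "B * \<pi> y j - S (\<Gamma> j) * g = B * \<pi> y j * (1 - S (\<Gamma> j)) + S (\<Gamma> j) * (A * \<xi> * \<pi> y (Suc j))"
      by (simp add: g_def algebra_simps)
    moreover have "0 < B * \<pi> y j * (1 - S (\<Gamma> j))"
      using \<open>0 < B\<close> S\<Gamma> state_prob_below_k_pos by (simp add: j_def)
    moreover have "0 \<le> S (\<Gamma> j) * (A * \<xi> * \<pi> y (Suc j))"
      using \<open>0 < A\<close> S\<Gamma> xi_pos state_prob_nonneg by simp
    ultimately show ?thesis
      using eta_k by (simp add: r_def)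
  qed
  \<comment> \<open>The cap 1 keeps the scaling factors nonnegative; the quotient keeps the entry of
    channel \<open>k\<close> within the full rate. The summand 1 avoids a zero denominator.\<close>
  define e where "e = min 1 ((full y j - y j k) / (1 + \<bar>r - g\<bar>))"
  have "0 < e" "e \<le> 1"
    using slack by (auto simp: e_def j_def intro!: divide_pos_pos)
  have "e * (r - g) \<le> full y j - y j k"
  proof -
    have "e * (r - g) \<le> e * (1 + \<bar>r - g\<bar>)"
      using \<open>0 < e\<close> by (intro mult_left_mono) auto
    also have "\<dots> \<le> (full y j - y j k) / (1 + \<bar>r - g\<bar>) * (1 + \<bar>r - g\<bar>)"
      by (intro mult_right_mono) (auto simp: e_def)
    also have "\<dots> = full y j - y j k"
      by simp
    finally show ?thesis .
  qed
  define c where "c i = (if i \<le> j then 1 + e * B else 1 - e * A)" for i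
  have "e * A \<le> 1 * 1"
    using \<open>0 < e\<close> \<open>e \<le> 1\<close> \<open>0 < A\<close> \<open>0 < B\<close> AB by (intro mult_mono) auto
  then have c_nonneg: "0 \<le> c i" for i
    using \<open>0 < e\<close> \<open>0 < B\<close> by (auto simp: c_def)
  \<comment> \<open>Off \<open>j\<close>, a state and its successor share a scaling factor, so
    scaling the row suffices. Row \<open>j\<close> sees both factors and is set explicitly.\<close>
  define z where "z i m = (if i \<noteq> j then c i * y i m else
    if th m \<le> j then full y j + e * g else if m = k then y j k + e * r else 0)" for i m
  have pi_z: "\<pi> z i = c i * \<pi> y i" for i
  proof (cases "i = j")
    case True
    have "\<pi> z j = S (\<Gamma> j) * (full y j + e * g) + \<eta> k * (y j k + e * r)"
      unfolding state_prob_def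
      by (subst sum_split_full[where i=j and f="full y j + e * g" and u="y j k + e * r"])
        (auto simp: z_def j)
    also have "\<dots> = (S (\<Gamma> j) * full y j + \<eta> k * y j k) + e * (S (\<Gamma> j) * g + \<eta> k * r)"
      by (simp add: algebra_simps)
    also have "\<dots> = c j * \<pi> y j"
      using r balance[of j] by (simp add: j c_def algebra_simps)
    finally show ?thesis
      using True by simp
  qed (simp add: state_prob_def z_def sum_distrib_left mult.left_commute)
  have full_z: "full z i = (if i = j then full y j + e * g else c i * full y i)" for i
    unfolding full_rate_def pi_z by (auto simp: c_def g_def algebra_simps)
  have 1: "threshold_form z"
    unfolding threshold_form_def full_z
  proof (intro allI ballI)
    fix i m assume m: "m \<in> {1..M}"
    show "z i m = (if th m \<le> i then if i = j then full y j + e * g else c i * full y i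
        else if m = k \<and> Suc i = th k then z i k else 0)"
      using j by (cases "i = j") (auto simp: z_def entry_eq[OF m, of i])
  qed
  have pi_z_nonneg: "0 \<le> \<pi> z i" for i
    using c_nonneg state_prob_nonneg by (simp add: pi_z)
  have full_z_nonneg: "0 \<le> full z i" for i
    unfolding full_rate_def using pi_z_nonneg xi_pos by simp
  have 2: "0 \<le> z i m \<and> z i m \<le> full z i" if m: "m \<in> {1..M}" for i m
  proof (cases "i = j")
    case True
    have "0 \<le> full y j + e * g"
      using full_z_nonneg[of j] by (simp add: full_z)
    moreover have "y j k + e * r \<le> full y j + e * g"
      using \<open>e * (r - g) \<le> full y j - y j k\<close> by (simp add: algebra_simps)
    moreover have "0 \<le> y j k + e * r"
      using nonneg[of k j] k_range \<open>0 < e\<close> \<open>0 < r\<close> by auto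
    ultimately show ?thesis
      using True by (simp add: z_def full_z)
  next
    case False
    then show ?thesis
      using nonneg[OF m, of i] entry_le_full[OF m, of i] c_nonneg[of i] by (simp add: z_def full_z mult_left_mono)
  qed
  have low: "(\<Sum>i\<le>j. f i * \<pi> z i) = (1 + e * B) * (\<Sum>i\<le>j. f i * \<pi> y i)" for f :: "nat \<Rightarrow> real"
    unfolding sum_distrib_left by (intro sum.cong) (auto simp: pi_z c_def)
  have high: "(\<Sum>i=Suc j..th M. f i * \<pi> z i) = (1 - e * A) * (\<Sum>i=Suc j..th M. f i * \<pi> y i)"
    for f :: "nat \<Rightarrow> real"
    unfolding sum_distrib_left by (intro sum.cong) (auto simp: pi_z c_def)
  have 3: "(\<Sum>i\<le>th M. \<pi> z i) = 1"
    using low[of "\<lambda>_. 1"] high[of "\<lambda>_. 1"] AB by (simp add: split A_def[symmetric] B_def[symmetric] algebra_simps)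
  \<comment> \<open>The lower states have mean at most \<open>j\<close>, the upper ones at least
    \<open>j + 1\<close>, so moving mass downwards lowers the delay.\<close>
  have 4: "(\<Sum>i\<le>th M. real i * \<pi> z i) < (\<Sum>i\<le>th M. real i * \<pi> y i)"
  proof -
    define L where "L = (\<Sum>i\<le>j. real i * \<pi> y i)"
    define H where "H = (\<Sum>i=Suc j..th M. real i * \<pi> y i)"
    have "L \<le> real j * A"
      unfolding L_def A_def sum_distrib_left by (intro sum_mono mult_right_mono) (auto simp: state_prob_nonneg)
    then have "B * L \<le> B * (real j * A)"
      using \<open>0 < B\<close> by simp
    also have "\<dots> < A * (real (Suc j) * B)"
      using \<open>0 < A\<close> \<open>0 < B\<close> by (simp add: algebra_simps)
    also have "real (Suc j) * B \<le> H"
      unfolding H_def B_def sum_distrib_left by (intro sum_mono mult_right_mono) (auto simp: state_prob_nonneg)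
    finally have "e * (B * L) < e * (A * H)"
      using \<open>0 < A\<close> \<open>0 < e\<close> by simp
    then show ?thesis
      by (simp add: split low high L_def[symmetric] H_def[symmetric] algebra_simps)
  qed
  have 5: "y (th k - 1) k < z (th k - 1) k"
    unfolding j_def[symmetric] using j \<open>0 < e\<close> \<open>0 < r\<close> by (simp add: z_def)
  show thesis
    using that 1 2 3 4 5 by blast
qed

text \<open>If channel \<open>k\<close> is used while the cheaper channel \<open>k - 1\<close> is idle, part of the load is moved to
  the latter; mixing with the policy that always empties the buffer then spends the saved power.\<close>

lemma exchange_below_k:
  assumes total: "(\<Sum>i\<le>th M. \<pi> y i) = 1"
    and tie: "th (k - 1) = th k" and used: "0 < y (th k - 1) k" and cheaper: "P (k - 1) < P k"
    and power: "(\<Sum>i\<le>th M. \<Sum>m=1..M. \<eta> m * P m * y i m) < (\<Sum>m=1..M. \<eta> m * P m)"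
  obtains z where "\<And>i m. m \<in> {1..M} \<Longrightarrow> 0 \<le> z i m \<and> z i m \<le> full z i"
    "\<And>i m. th M < i \<Longrightarrow> m \<in> {1..M} \<Longrightarrow> z i m = 0"
    "(\<Sum>i\<le>th M. \<pi> z i) = 1" "(\<Sum>i\<le>th M. real i * \<pi> z i) < (\<Sum>i\<le>th M. real i * \<pi> y i)"
    "(\<Sum>i\<le>th M. \<Sum>m=1..M. \<eta> m * P m * z i m) \<le> (\<Sum>i\<le>th M. \<Sum>m=1..M. \<eta> m * P m * y i m)"
proof -
  define j where "j = th k - 1"
  have j: "Suc j = th k" "j < th M"
    using th_k_pos th_k_le by (auto simp: j_def)
  have k: "k - 1 \<in> {1..M}" "k \<in> {1..M}" "k - 1 \<noteq> k"
    using k_range by auto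
  have eta: "0 < \<eta> k" "0 < \<eta> (k - 1)"
    using eta_pos k by auto
  have full_j: "0 < full y j"
    using used slack by (simp add: j_def)
  \<comment> \<open>The first bound keeps channel \<open>k\<close> nonnegative, the second keeps the
    idle channel \<open>k - 1\<close> within its full rate.\<close>
  define \<kappa> where "\<kappa> = min (y j k / \<eta> (k - 1)) (full y j / \<eta> k)"
  have \<kappa>: "0 < \<kappa>" "\<kappa> * \<eta> (k - 1) \<le> y j k" "\<kappa> * \<eta> k \<le> full y j"
    using eta used full_j by (auto simp: \<kappa>_def j_def min_mult_distrib_right min_le_iff_disj)
  \<comment> \<open>The crossed weights make the \<open>\<eta>\<close>-weighted sum of the shift
    zero: the stationary distribution is unchanged, while the power drops by
    \<open>\<delta>\<close>.\<close>
  define s where "s m = (if m = k - 1 then \<kappa> * \<eta> k else 0) - (if m = k then \<kappa> * \<eta> (k - 1) else 0)" for m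
  have sum_s: "(\<Sum>m=1..M. \<eta> m * (c m * s m)) = \<kappa> * \<eta> k * \<eta> (k - 1) * (c (k - 1) - c k)" for c :: "nat \<Rightarrow> real"
  proof -
    have "(\<Sum>m=1..M. \<eta> m * (c m * s m)) = (\<Sum>m=1..M. (if m = k - 1 then \<eta> m * c m * \<kappa> * \<eta> k else 0) -
        (if m = k then \<eta> m * c m * \<kappa> * \<eta> (k - 1) else 0))"
      by (intro sum.cong) (auto simp: s_def algebra_simps)
    then show ?thesis
      using k by (simp add: sum_subtractf algebra_simps)
  qed
  define p where "p i = (\<Sum>m=1..M. \<eta> m * P m * y i m)" for i
  define pw where "pw = (\<Sum>i\<le>th M. p i)"
  define T where "T = (\<Sum>m=1..M. \<eta> m * P m)"
  define \<delta> where "\<delta> = \<kappa> * \<eta> k * \<eta> (k - 1) * (P k - P (k - 1))"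
  have "0 < \<delta>"
    using \<kappa>(1) eta cheaper by (simp add: \<delta>_def)
  have "pw < T"
    using power by (simp add: pw_def p_def T_def)
  \<comment> \<open>Solves \<open>(1 - t) * (pw - \<delta>) + t * T = pw\<close>, so the mixture
    spends exactly the saved power.\<close>
  define t where "t = \<delta> / (T - pw + \<delta>)"
  have t: "0 < t" "t < 1" "t * (T - pw + \<delta>) = \<delta>"
    using \<open>0 < \<delta>\<close> \<open>pw < T\<close> by (auto simp: t_def)
  define v where "v i m = y i m + (if i = j then s m else 0)" for i m
  \<comment> \<open>The second component has all mass in state 0 and every channel in full use
    there: it has no delay and power sum \<open>T\<close>.\<close>
  define z where "z i m = (1 - t) * v i m + t * of_bool (i = 0)" for i m
  have pi_v: "\<pi> v i = \<pi> y i" for i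
    using sum_s[of "\<lambda>_. 1"]
    by (cases "i = j") (simp_all add: state_prob_def v_def distrib_left sum.distrib)
  have pi_z: "\<pi> z i = (1 - t) * \<pi> y i + t * of_bool (i = 0)" for i
  proof -
    have "\<pi> z i = (1 - t) * \<pi> v i + (\<Sum>m=1..M. \<eta> m) * (t * of_bool (i = 0))"
      unfolding state_prob_def z_def sum_distrib_left sum_distrib_right sum.distrib[symmetric]
      by (intro sum.cong) (auto simp: algebra_simps)
    then show ?thesis
      by (simp only: pi_v eta_sum mult_1)
  qed
  have full_z: "full z i = (1 - t) * full y i + t * of_bool (i = 0)" for i
    by (simp add: full_rate_def pi_z algebra_simps)
  have v_bounds: "0 \<le> v i m \<and> v i m \<le> full y i" if m: "m \<in> {1..M}" for i m
  proof (cases "i = j \<and> m \<in> {k - 1, k}")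
    case True
    moreover have "y j (k - 1) = 0"
      using entry_eq[OF k(1), of j] k j tie by auto
    moreover have "0 \<le> \<kappa> * \<eta> k" "0 \<le> \<kappa> * \<eta> (k - 1)"
      using \<kappa>(1) eta by auto
    ultimately show ?thesis
      using k(3) \<kappa> entry_le_full[OF k(2), of j] by (auto simp: v_def s_def)
  next
    case False
    then show ?thesis
      using nonneg[OF m, of i] entry_le_full[OF m, of i] by (auto simp: v_def s_def)
  qed
  have 1: "0 \<le> z i m \<and> z i m \<le> full z i" if "m \<in> {1..M}" for i m
    using v_bounds[OF that, of i] t by (simp add: z_def full_z mult_left_mono)
  have 2: "z i m = 0" if "th M < i" "m \<in> {1..M}" for i m
    using that j entry_zero[of i m] by (simp add: z_def v_def)
  have 3: "(\<Sum>i\<le>th M. \<pi> z i) = 1"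
    using total by (simp add: pi_z sum.distrib sum_distrib_left[symmetric])
  have 4: "(\<Sum>i\<le>th M. real i * \<pi> z i) < (\<Sum>i\<le>th M. real i * \<pi> y i)"
  proof -
    have "(\<Sum>i\<le>th M. real i * \<pi> z i) = (1 - t) * (\<Sum>i\<le>th M. real i * \<pi> y i)"
      unfolding sum_distrib_left by (intro sum.cong) (auto simp: pi_z)
    moreover have "0 < (\<Sum>i\<le>th M. real i * \<pi> y i)"
      using th_k_le th_k_pos state_prob_k_pos state_prob_nonneg by (intro sum_pos2[of _ "th k"]) auto
    ultimately show ?thesis
      using t(1) by (simp add: left_diff_distrib)
  qed
  have "(\<Sum>m=1..M. \<eta> m * P m * z i m) = (1 - t) * (p i + (if i = j then - \<delta> else 0)) + t * (if i = 0 then T else 0)" for i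
  proof -
    have "(\<Sum>m=1..M. \<eta> m * P m * z i m) =
        (1 - t) * (p i + (if i = j then \<Sum>m=1..M. \<eta> m * (P m * s m) else 0)) + t * (if i = 0 then T else 0)"
      by (cases "i = j"; cases "i = 0")
        (simp_all add: p_def T_def z_def v_def sum.distrib[symmetric] sum_distrib_left algebra_simps)
    then show ?thesis
      by (simp only: sum_s) (simp add: \<delta>_def algebra_simps)
  qed
  then have "(\<Sum>i\<le>th M. \<Sum>m=1..M. \<eta> m * P m * z i m) = (1 - t) * (pw - \<delta>) + t * T"
    using j by (simp add: sum.distrib sum_distrib_left[symmetric] pw_def)
  also have "\<dots> = pw"
    using t(3) by (simp add: algebra_simps)
  finally have 5: "(\<Sum>i\<le>th M. \<Sum>m=1..M. \<eta> m * P m * z i m) \<le> (\<Sum>i\<le>th M. \<Sum>m=1..M. \<eta> m * P m * y i m)"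
    by (simp add: pw_def p_def)
  show thesis
    using that 1 2 3 4 5 by blast
qed

end

end

end

section \<open>Passage to the linear program\<close>

lemma avg_power_finite_support:
  assumes "enat N \<le> Q" "\<And>i m. N < i \<Longrightarrow> m \<in> {1..M} \<Longrightarrow> y i m = 0"
  shows "avg_power M \<alpha> \<eta> P Q y = \<alpha> * (\<Sum>i\<le>N. \<Sum>m=1..M. \<eta> m * P m * y i m)"
  unfolding avg_power_def using assms by (subst infsum_finite_support[of N]) auto

lemma avg_delay_finite_support:
  assumes "enat N \<le> Q" "\<And>i m. N < i \<Longrightarrow> m \<in> {1..M} \<Longrightarrow> y i m = 0"
    and "0 < \<alpha>" and nonneg: "\<And>i m. m \<in> {1..M} \<Longrightarrow> 0 \<le> \<eta> m * y i m"
  shows "avg_delay M \<alpha> \<eta> Q y = ennreal (1 / \<alpha> * (\<Sum>i\<le>N. real i * state_prob M \<eta> y i))"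
proof -
  have pos: "0 \<le> real i * state_prob M \<eta> y i" for i
    unfolding state_prob_def using nonneg by (intro mult_nonneg_nonneg[OF _ sum_nonneg]) auto
  have "avg_delay M \<alpha> \<eta> Q y = ennreal (1 / \<alpha>) *
      (\<Sum>\<^sub>\<infinity>i\<in>queue_states Q. ennreal (real i * state_prob M \<eta> y i))"
    by (simp add: avg_delay_def state_prob_def sum_distrib_left mult.assoc)
  also have "\<dots> = ennreal (1 / \<alpha>) * (\<Sum>i\<le>N. ennreal (real i * state_prob M \<eta> y i))"
    using assms(1,2) by (subst infsum_finite_support[of N]) (auto simp: state_prob_def)
  also have "(\<Sum>i\<le>N. ennreal (real i * state_prob M \<eta> y i)) = ennreal (\<Sum>i\<le>N. real i * state_prob M \<eta> y i)"
    using pos by (intro sum_ennreal) auto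
  finally show ?thesis
    using assms(3) by (simp add: ennreal_mult' divide_inverse)
qed

text \<open>Otherwise \<open>z\<close> would be feasible and beat \<open>y\<close>. The strict bound
  \<open>N < Q\<close> leaves the last state of a finite buffer empty, as the overflow condition
  demands.\<close>

lemma lp_optimal_less_power:
  assumes opt: "lp_optimal M \<alpha> \<eta> P Q pmax y" and "0 < \<alpha>" and N: "enat N < Q"
    and eta: "\<And>m. m \<in> {1..M} \<Longrightarrow> 0 \<le> \<eta> m"
    and y: "\<And>i m. m \<in> {1..M} \<Longrightarrow> 0 \<le> y i m" "\<And>i m. N < i \<Longrightarrow> m \<in> {1..M} \<Longrightarrow> y i m = 0"
    and z: "\<And>i m. m \<in> {1..M} \<Longrightarrow> 0 \<le> z i m \<and> z i m \<le> full_rate M \<alpha> \<eta> z i"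
      "\<And>i m. N < i \<Longrightarrow> m \<in> {1..M} \<Longrightarrow> z i m = 0"
    and "(\<Sum>i\<le>N. state_prob M \<eta> z i) = 1"
    and less: "(\<Sum>i\<le>N. real i * state_prob M \<eta> z i) < (\<Sum>i\<le>N. real i * state_prob M \<eta> y i)"
  shows "pmax < \<alpha> * (\<Sum>i\<le>N. \<Sum>m=1..M. \<eta> m * P m * z i m)"
proof (rule ccontr)
  have le: "enat N \<le> Q"
    using N by simp
  assume "\<not> ?thesis"
  then have "avg_power M \<alpha> \<eta> P Q z \<le> pmax"
    using avg_power_finite_support[where N=N and y=z] le z(2) by simp
  moreover have "(\<Sum>\<^sub>\<infinity>i\<in>queue_states Q. \<Sum>m=1..M. \<eta> m * z i m) = 1"
    using infsum_finite_support[OF le, of "\<lambda>i. \<Sum>m=1..M. \<eta> m * z i m"] z(2) assms(9)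
    by (simp add: state_prob_def)
  moreover have "z i m = 0" if "i \<notin> queue_states Q" "m \<in> {1..M}" for i m
  proof -
    have "enat N < enat i"
      using that(1) N by (simp only: queue_states_def mem_Collect_eq not_le)
    then show ?thesis
      using z(2) that by simp
  qed
  moreover have "state_prob M \<eta> z q = 0" if "Q = enat q" for q
    using that N z(2) by (simp add: state_prob_def)
  ultimately have "lp_feasible M \<alpha> \<eta> P Q pmax z"
    using z(1) unfolding lp_feasible_def by blast
  then have "avg_delay M \<alpha> \<eta> Q y \<le> avg_delay M \<alpha> \<eta> Q z"
    using opt by (simp add: lp_optimal_def)
  then have "ennreal (1 / \<alpha> * (\<Sum>i\<le>N. real i * state_prob M \<eta> y i)) \<le>
      ennreal (1 / \<alpha> * (\<Sum>i\<le>N. real i * state_prob M \<eta> z i))"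
    using avg_delay_finite_support[of N Q M y, OF le y(2) \<open>0 < \<alpha>\<close>]
      avg_delay_finite_support[of N Q M z, OF le z(2) \<open>0 < \<alpha>\<close>] y(1) z(1) eta by simp
  \<comment> \<open>\<open>ennreal\<close> truncates negative numbers, so the return to real numbers
    needs this sign.\<close>
  moreover have "0 \<le> 1 / \<alpha> * (\<Sum>i\<le>N. real i * state_prob M \<eta> z i)"
    unfolding state_prob_def using z(1) eta \<open>0 < \<alpha>\<close> by (intro mult_nonneg_nonneg sum_nonneg) auto
  ultimately have "1 / \<alpha> * (\<Sum>i\<le>N. real i * state_prob M \<eta> y i) \<le> 1 / \<alpha> * (\<Sum>i\<le>N. real i * state_prob M \<eta> z i)"
    by (simp add: ennreal_le_iff)
  then show False
    using less \<open>0 < \<alpha>\<close> by (simp add: divide_right_mono divide_le_cancel)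
qed

text \<open>The structure speaks of queue states only; outside them both \<open>y\<close> and its
  full rate vanish, which extends the formula to all states.\<close>

lemma threshold_structure_form:
  assumes "threshold_params M \<alpha> \<eta> th k" and str: "threshold_structure M \<alpha> \<eta> P Q y th k"
    and zero: "\<And>i m. i \<notin> queue_states Q \<Longrightarrow> m \<in> {1..M} \<Longrightarrow> y i m = 0"
  shows "threshold_params.threshold_form M \<alpha> \<eta> th k y"
proof -
  interpret threshold_params M \<alpha> \<eta> th k
    by fact
  have full_zero: "full y i = 0" if "i \<notin> queue_states Q" for i
  proof -
    have "enat i \<le> enat (Suc i)"
      by simp
    then have "Suc i \<notin> queue_states Q"
      using that order_trans unfolding queue_states_def by blast
    then show ?thesis
      using that zero by (simp add: full_rate_def state_prob_def)
  qed
  show ?thesis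
    unfolding threshold_form_def
  proof (intro allI ballI)
    fix i m assume m: "m \<in> {1..M}"
    consider "i \<notin> queue_states Q" | "i \<in> queue_states Q" "th m \<le> i" | "i \<in> queue_states Q" "Suc i < th m"
      | "i \<in> queue_states Q" "Suc i = th m" "m = k" | "i \<in> queue_states Q" "Suc i = th m" "m \<noteq> k"
      by linarith
    then show "y i m = (if th m \<le> i then full y i else if m = k \<and> Suc i = th k then y i k else 0)"
    proof cases
      \<comment> \<open>Here \<open>th m\<close> is positive, so \<open>th 1 = 0\<close> rules out
        \<open>m = 1\<close>.\<close>
      case 5
      then have "m \<in> {2..M} - {k}" "0 < th m" "th m - 1 = i"
        using m th_1 by (cases "m = 1"; auto)+
      then have "y i m = 0"
        using str unfolding threshold_structure_def by blast
      then show ?thesis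
        using 5 by simp
    qed (use zero full_zero m str k_range in \<open>auto simp: threshold_structure_def\<close>)
  qed
qed

section \<open>Solving normalisation and power for the two unknowns\<close>

theorem theorem4:
  fixes M :: nat and \<alpha> pmax :: real and \<eta> P :: "nat \<Rightarrow> real" and Q :: enat
    and y :: "nat \<Rightarrow> nat \<Rightarrow> real" and th :: "nat \<Rightarrow> nat" and k :: nat
    and \<pi> \<phi>1 \<phi>2 :: "nat \<Rightarrow> real" and \<theta>1 \<theta>2 \<nu>1 \<nu>2 :: real
  assumes "1 \<le> M" and "0 < \<alpha>" and "\<alpha> < 1" and "0 < Q"
    and "\<forall>m\<in>{1..M}. 0 < \<eta> m" and "(\<Sum>m=1..M. \<eta> m) = 1"
    and "\<forall>m\<in>{1..M}. 0 \<le> P m" and "mono_on {1..M} P"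
    and "lp_optimal M \<alpha> \<eta> P Q pmax y"
    and "avg_power M \<alpha> \<eta> P Q y = pmax"
    and "pmax < \<alpha> * (\<Sum>m=1..M. \<eta> m * P m)"
    and "threshold_structure M \<alpha> \<eta> P Q y th k"
    and "\<pi> = state_prob M \<eta> y"
    and "\<phi>1 = phi1 M \<alpha> \<eta> th" and "\<phi>2 = phi2 M \<alpha> \<eta> th k"
    and "\<theta>1 = theta1 M \<alpha> \<eta> P th" and "\<theta>2 = theta2 M \<alpha> \<eta> P th k"
    and "\<nu>1 = (\<Sum>i=0..th M. \<phi>1 i)" and "\<nu>2 = (\<Sum>i=0..th M. \<phi>2 i)"
  shows "\<nu>2 \<noteq> 0 \<and> \<theta>1 - \<nu>1 / \<nu>2 * \<theta>2 \<noteq> 0 \<and>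
    (\<forall>i\<in>queue_states Q. \<pi> i = \<phi>2 i / \<nu>2 + (\<phi>1 i - \<nu>1 / \<nu>2 * \<phi>2 i) * \<pi> 0) \<and>
    \<pi> 0 = (pmax / \<alpha> - \<theta>2 / \<nu>2) * inverse (\<theta>1 - \<nu>1 / \<nu>2 * \<theta>2)"
proof -
  note str = assms(12)[unfolded threshold_structure_def]
  have params: "threshold_params M \<alpha> \<eta> th k"
    using assms(2,3,5,6) str by unfold_locales auto
  interpret tp: threshold_params M \<alpha> \<eta> th k
    by (rule params)
  have feas: "lp_feasible M \<alpha> \<eta> P Q pmax y"
    using assms(9) by (simp add: lp_optimal_def)
  have zero: "y i m = 0" if "i \<notin> queue_states Q" "m \<in> {1..M}" for i m
    using feas that unfolding lp_feasible_def by blast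
  have nonneg: "0 \<le> y i m" if "m \<in> {1..M}" for i m
    using feas that zero unfolding lp_feasible_def by (cases "i \<in> queue_states Q") auto
  have form: "tp.threshold_form y"
    using threshold_structure_form[OF params assms(12)] zero by blast
  have slack: "y (th k - 1) k < full_rate M \<alpha> \<eta> y (th k - 1)"
    using str by blast
  have k: "k \<in> {2..M}" "k \<in> {1..M}" "k - 1 \<in> {1..M}"
    using str by auto
  have pi_N: "0 < state_prob M \<eta> y (th M)"
    using tp.state_prob_pos[OF form nonneg slack] tp.th_k_le by blast
  \<comment> \<open>State \<open>th M\<close> carries mass: hence it lies in the buffer, and it
    cannot be the overflow state.\<close>
  have N: "enat (th M) < Q"
  proof -
    have "th M \<in> queue_states Q"
      using pi_N zero[of "th M"] by (force simp: state_prob_def)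
    moreover have "Q \<noteq> enat (th M)"
      using pi_N feas unfolding lp_feasible_def by force
    ultimately show ?thesis
      by (simp add: queue_states_def)
  qed
  then have N_le: "enat (th M) \<le> Q"
    by simp
  note y_zero = tp.entry_zero[OF form]
  define p where "p z = (\<Sum>i\<le>th M. \<Sum>m=1..M. \<eta> m * P m * z i m)" for z :: "nat \<Rightarrow> nat \<Rightarrow> real"
  have power: "pmax = \<alpha> * p y"
    using avg_power_finite_support[of "th M" Q M y, OF N_le y_zero] assms(10) by (simp add: p_def)
  have total: "(\<Sum>i\<le>th M. state_prob M \<eta> y i) = 1"
    using infsum_finite_support[OF N_le, of "\<lambda>i. \<Sum>m=1..M. \<eta> m * y i m"] feas y_zero
    by (simp add: lp_feasible_def state_prob_def)
  \<comment> \<open>The power constraint is tight at \<open>y\<close>, so optimality means that less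
    delay costs strictly more power.\<close>
  have improve: "p y < p z"
    if "\<And>i m. m \<in> {1..M} \<Longrightarrow> 0 \<le> z i m \<and> z i m \<le> full_rate M \<alpha> \<eta> z i"
      "\<And>i m. th M < i \<Longrightarrow> m \<in> {1..M} \<Longrightarrow> z i m = 0" "(\<Sum>i\<le>th M. state_prob M \<eta> z i) = 1"
      "(\<Sum>i\<le>th M. real i * state_prob M \<eta> z i) < (\<Sum>i\<le>th M. real i * state_prob M \<eta> y i)" for z
  proof -
    have "pmax < \<alpha> * p z"
      unfolding p_def using assms(2,5) nonneg y_zero that
      by (intro lp_optimal_less_power[OF assms(9) _ N]) (auto simp: less_imp_le)
    then show ?thesis
      using power assms(2) by simp
  qed
  have nu: "0 < \<nu>1" "\<nu>2 < 0"
    using tp.nu1_pos tp.nu2_neg by (auto simp: assms(14,15,18,19) atLeast0AtMost)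
  define w where "w = y (th k - 1) k"
  define \<theta>2' where "\<theta>2' = tp.rho * (\<theta>2 - \<eta> k * P k) + \<eta> k * P k"
  have sums: "p z = \<theta>1 * state_prob M \<eta> z 0 + \<theta>2' * z (th k - 1) k"
    "(\<Sum>i\<le>th M. state_prob M \<eta> z i) = \<nu>1 * state_prob M \<eta> z 0 + \<nu>2 * (tp.rho * z (th k - 1) k)"
    if "tp.threshold_form z" for z
    using tp.power_linear[OF that, of P] tp.sum_state_prob[OF that]
    by (simp_all add: p_def \<theta>2'_def assms(14-19) atLeast0AtMost)
  \<comment> \<open>The sign of the determinant. From \<open>y\<close> to \<open>z\<close> the total
    is kept, so the increments satisfy \<open>\<nu>1 * a = - \<nu>2 * rho * b\<close>; the power
    rises and \<open>b\<close> is positive.\<close>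
  have "\<theta>1 * \<nu>2 * tp.rho < \<nu>1 * \<theta>2'"
  proof -
    obtain z where z: "tp.threshold_form z"
      "\<And>i m. m \<in> {1..M} \<Longrightarrow> 0 \<le> z i m \<and> z i m \<le> full_rate M \<alpha> \<eta> z i"
      "(\<Sum>i\<le>th M. state_prob M \<eta> z i) = 1"
      "(\<Sum>i\<le>th M. real i * state_prob M \<eta> z i) < (\<Sum>i\<le>th M. real i * state_prob M \<eta> y i)"
      "w < z (th k - 1) k"
      using tp.increase_below_k[OF form nonneg slack total] unfolding w_def by blast
    define a b where "a = state_prob M \<eta> z 0 - state_prob M \<eta> y 0" and "b = z (th k - 1) k - w"
    have "p y < p z"
      using improve[OF z(2) _ z(3,4)] tp.entry_zero[OF z(1)] by blast
    then have "0 < \<theta>1 * a + \<theta>2' * b"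
      using sums(1)[OF form] sums(1)[OF z(1)] by (simp add: a_def b_def w_def algebra_simps)
    then have "0 < \<nu>1 * (\<theta>1 * a + \<theta>2' * b)"
      using nu(1) by simp
    also have "\<nu>1 * (\<theta>1 * a + \<theta>2' * b) = \<theta>1 * (\<nu>1 * a) + \<nu>1 * \<theta>2' * b"
      by (simp add: algebra_simps)
    also have "\<nu>1 * a = - \<nu>2 * tp.rho * b"
      using sums(2)[OF form] sums(2)[OF z(1)] total z(3) by (simp add: a_def b_def w_def algebra_simps)
    finally have "0 < (\<nu>1 * \<theta>2' - \<theta>1 * \<nu>2 * tp.rho) * b"
      by (simp add: algebra_simps)
    then show ?thesis
      using z(5) by (simp add: b_def zero_less_mult_iff)
  qed
  \<comment> \<open>As \<open>rho\<close> is at least 1 and \<open>P k\<close> nonnegative, passing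
    from \<open>\<theta>2'\<close> to \<open>rho * \<theta>2\<close> preserves the strict
    inequality; afterwards \<open>rho\<close> cancels.\<close>
  moreover have "\<nu>1 * \<theta>2' \<le> \<nu>1 * \<theta>2 * tp.rho"
  proof -
    have "0 \<le> \<eta> k * P k"
      using assms(5,7) k by (simp add: less_imp_le)
    then have "\<eta> k * P k \<le> tp.rho * (\<eta> k * P k)"
      using tp.rho_ge_1 mult_right_mono[of 1 tp.rho] by simp
    then have "\<theta>2' \<le> \<theta>2 * tp.rho"
      by (simp add: \<theta>2'_def algebra_simps)
    then show ?thesis
      using nu(1) mult_left_mono[of \<theta>2' "\<theta>2 * tp.rho" \<nu>1] by (simp add: mult.assoc)
  qed
  ultimately have "\<theta>1 * \<nu>2 * tp.rho < \<nu>1 * \<theta>2 * tp.rho"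
    by linarith
  then have det: "\<theta>1 * \<nu>2 < \<nu>1 * \<theta>2"
    using tp.rho_ge_1 by (simp add: mult_less_cancel_right)
  \<comment> \<open>Either the open entry is 0, or the exchange argument separates the thresholds of
    \<open>k - 1\<close> and \<open>k\<close>, and then \<open>rho = 1\<close>.\<close>
  have w: "tp.rho * w = w"
  proof (cases "w = 0")
    case False
    then have "0 < w"
      using nonneg[OF k(2), of "th k - 1"] by (simp add: w_def)
    have "th (k - 1) < th k"
    proof (rule ccontr)
      assume "\<not> th (k - 1) < th k"
      then have tie: "th (k - 1) = th k"
        using tp.th_le[of "k-1" k] k by auto
      then have "P (k - 1) \<noteq> P k"
        using str \<open>0 < w\<close> by (auto simp: w_def)
      then have cheaper: "P (k - 1) < P k"
        using assms(8) k unfolding mono_on_def by (metis diff_le_self less_eq_real_def)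
      have "p y < (\<Sum>m=1..M. \<eta> m * P m)"
        using assms(2,11) power by simp
      then obtain z where "\<And>i m. m \<in> {1..M} \<Longrightarrow> 0 \<le> z i m \<and> z i m \<le> full_rate M \<alpha> \<eta> z i"
        "\<And>i m. th M < i \<Longrightarrow> m \<in> {1..M} \<Longrightarrow> z i m = 0" "(\<Sum>i\<le>th M. state_prob M \<eta> z i) = 1"
        "(\<Sum>i\<le>th M. real i * state_prob M \<eta> z i) < (\<Sum>i\<le>th M. real i * state_prob M \<eta> y i)"
        "p z \<le> p y"
        using tp.exchange_below_k[OF form nonneg slack total tie _ cheaper] \<open>0 < w\<close>
        unfolding w_def p_def by blast
      then show False
        using improve[of z] by fastforce
    qed
    then have "\<not> th k \<le> th k - 1" "th (k - 1) \<le> th k - 1"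
      by auto
    then have "tp.\<Gamma> (th k - 1) = k - 1"
      using tp.th_le_iff[OF k(3)] tp.Gam_below_k by fastforce
    then have "tp.rho = 1"
      using tp.S_pos[of "k-1"] k by (simp add: tp.rho_def)
    then show ?thesis
      by simp
  qed simp
  have pi: "\<pi> i = \<phi>1 i * \<pi> 0 + \<phi>2 i * w" for i
    using tp.state_prob_linear[OF form, of i] w by (auto simp: assms(13-15) w_def)
  have one: "1 = \<nu>1 * \<pi> 0 + \<nu>2 * w"
    using sums(2)[OF form] total w by (auto simp: assms(13) w_def)
  have "\<theta>2' * w = \<theta>2 * w"
  proof -
    have "\<theta>2' * w = (\<theta>2 - \<eta> k * P k) * (tp.rho * w) + \<eta> k * P k * w"
      by (simp add: \<theta>2'_def algebra_simps)
    then show ?thesis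
      by (simp only: w) (simp add: algebra_simps)
  qed
  then have pmax: "pmax / \<alpha> = \<theta>1 * \<pi> 0 + \<theta>2 * w"
    using sums(1)[OF form] power assms(2) by (simp add: assms(13) w_def)
  \<comment> \<open>Eliminating \<open>w\<close> by normalisation turns the formulas for
    \<open>\<pi> i\<close> and \<open>pmax / \<alpha>\<close> into the claimed ones.\<close>
  have w_eq: "w = (1 - \<nu>1 * \<pi> 0) / \<nu>2"
    using one nu(2) by (simp add: field_simps)
  have det': "\<theta>1 - \<nu>1 / \<nu>2 * \<theta>2 \<noteq> 0"
    using det nu(2) by (simp add: field_simps)
  have "\<pi> i = \<phi>2 i / \<nu>2 + (\<phi>1 i - \<nu>1 / \<nu>2 * \<phi>2 i) * \<pi> 0" for i
    unfolding pi[of i] w_eq using nu(2) by (simp add: field_simps)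
  moreover have "pmax / \<alpha> - \<theta>2 / \<nu>2 = \<pi> 0 * (\<theta>1 - \<nu>1 / \<nu>2 * \<theta>2)"
    unfolding pmax w_eq using nu(2) by (simp add: field_simps)
  then have "\<pi> 0 = (pmax / \<alpha> - \<theta>2 / \<nu>2) * inverse (\<theta>1 - \<nu>1 / \<nu>2 * \<theta>2)"
    using det' by (simp add: divide_inverse[symmetric])
  ultimately show ?thesis
    using nu(2) det' by blast
qed

end
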